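(* Let $\mathcal A,\mathcal B$ be unital Banach algebras with units $1_{\mathcal A},1_{\mathcal B}$, let $\mathcal M$ be a unital Banach $\mathcal A$-$\mathcal B$-bimodule, let $\mathcal T=\mathrm{Tri}(\mathcal A,\mathcal M,\mathcal B)$, and let $\sigma,\tau:\mathcal T\to\mathcal T$ be continuous homomorphisms with $\sigma(1_{\mathcal A}\oplus 0)=\tau(1_{\mathcal A}\oplus 0)=1_{\mathcal A}\oplus 0$ and $\sigma(0\oplus 1_{\mathcal B})=\tau(0\oplus 1_{\mathcal B})=0\oplus 1_{\mathcal B}$. Then $$H^1_{(\sigma,\tau)}(\mathcal T,\mathcal T^* )=H^1_{(\sigma,\tau)}(\mathcal A,\mathcal A^* )\oplus H^1_{(\sigma,\tau)}(\mathcal B,\mathcal B^* )$$ (equality meaning isomorphism of vector spaces).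
   Context: $\mathrm{Tri}(\mathcal A,\mathcal M,\mathcal B)$ is the algebra of matrices $\begin{bmatrix}a&m\\0&b\end{bmatrix}$ ($a\in\mathcal A$, $m\in\mathcal M$, $b\in\mathcal B$) with the usual matrix addition and multiplication and the norm $\|a\|+\|m\|+\|b\|$. A unital Banach $\mathcal A$-$\mathcal B$-bimodule satisfies $a(mb)=(am)b$ and $1_{\mathcal A}m=m1_{\mathcal B}=m$. Write $a\oplus b=\begin{bmatrix}a&0\\0&b\end{bmatrix}$; identify $a\in\mathcal A$ with $a\oplus 0$ and $b\in\mathcal B$ with $0\oplus b$. The conditions on $\sigma,\tau$ imply $\sigma(\mathcal A)\subseteq\mathcal A$, $\sigma(\mathcal B)\subseteq\mathcal B$ and likewise for $\tau$; the restrictions of $\sigma,\tau$ to $\mathcal A$ and to $\mathcal B$ are denoted again by $\sigma,\tau$. For a Banach algebra $\mathcal C$, the topological dual $\mathcal C^*$ is a Banach $\mathcal C$-bimodule via $(c\cdot f)(s)=f(sc)$, $(f\cdot c)(s)=f(cs)$. For a Banach algebra $\mathcal C$, continuous homomorphisms $\sigma,\tau:\mathcal C\to\mathcal C$ and a Banach $\mathcal C$-bimodule $\mathcal E$: a $(\sigma,\tau)$-derivation is a linear map $d:\mathcal C\to\mathcal E$ with $d(ab)=d(a)\sigma(b)+\tau(a)d(b)$ for all $a,b\in\mathcal C$; it is $(\sigma,\tau)$-inner if there is $x\in\mathcal E$ with $d(a)=\tau(a)x-x\sigma(a)$ for all $a$. $Z^1_{(\sigma,\tau)}(\mathcal C,\mathcal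 E)$ is the space of continuous $(\sigma,\tau)$-derivations, $B^1_{(\sigma,\tau)}(\mathcal C,\mathcal E)$ the subspace of $(\sigma,\tau)$-inner ones, and $H^1_{(\sigma,\tau)}(\mathcal C,\mathcal E)=Z^1_{(\sigma,\tau)}(\mathcal C,\mathcal E)/B^1_{(\sigma,\tau)}(\mathcal C,\mathcal E)$. *)

theory Defs
  imports "HOL-Analysis.Analysis"
begin

section \<open>Banach algebras and bimodules over the scalar field\<close>

text \<open>
  The scalars form a type \<open>'k\<close> of class \<^class>\<open>real_normed_field\<close>.  By the Gelfand--Mazur theorem
  such a field is the real or the complex numbers, so both kinds of Banach algebra are covered.
  Since class \<^class>\<open>banach\<close> only knows real scalars, the multiplication by elements of \<open>'k\<close> is an
  explicit parameter extending \<^const>\<open>scaleR\<close>.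
\<close>

locale banach_scaling = vector_space scale
  for scale :: "'k::real_normed_field \<Rightarrow> 'v::banach \<Rightarrow> 'v" +
  assumes norm_scale: "norm (scale c x) = norm c * norm x"
    and scale_of_real: "scale (of_real r) x = r *\<^sub>R x"

record ('k, 'c) alg =
  ascale :: "'k \<Rightarrow> 'c \<Rightarrow> 'c"
  amult :: "'c \<Rightarrow> 'c \<Rightarrow> 'c"
  aone :: 'c

text \<open>The unit is not required to have norm 1: the unit of a triangular algebra usually does not.\<close>

locale unital_banach_algebra = banach_scaling "ascale A"
  for A :: "('k::real_normed_field, 'c::banach) alg" +
  assumes mult_assoc: "amult A (amult A x y) z = amult A x (amult A y z)"
    and mult_add_left: "amult A (x + y) z = amult A x z + amult A y z"
    and mult_add_right: "amult A x (y + z) = amult A x y + amult A x z"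
    and mult_scale_left: "amult A (ascale A c x) y = ascale A c (amult A x y)"
    and mult_scale_right: "amult A x (ascale A c y) = ascale A c (amult A x y)"
    and mult_one_left: "amult A (aone A) x = x"
    and mult_one_right: "amult A x (aone A) = x"
    and norm_mult: "norm (amult A x y) \<le> norm x * norm y"

record ('k, 'a, 'b, 'm) bimod =
  mscale :: "'k \<Rightarrow> 'm \<Rightarrow> 'm"
  lact :: "'a \<Rightarrow> 'm \<Rightarrow> 'm"
  ract :: "'m \<Rightarrow> 'b \<Rightarrow> 'm"

text \<open>The module actions are jointly continuous; their norms may exceed 1.\<close>

locale unital_banach_bimodule =
  A: unital_banach_algebra A + B: unital_banach_algebra B + banach_scaling "mscale M"
  for A :: "('k::real_normed_field, 'a::banach) alg"
    and B :: "('k, 'b::banach) alg"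
    and M :: "('k, 'a, 'b, 'm::banach) bimod" +
  assumes bounded_bilinear_lact: "bounded_bilinear (lact M)"
    and bounded_bilinear_ract: "bounded_bilinear (ract M)"
    and lact_scale_left: "lact M (ascale A c a) m = mscale M c (lact M a m)"
    and lact_scale_right: "lact M a (mscale M c m) = mscale M c (lact M a m)"
    and ract_scale_left: "ract M (mscale M c m) b = mscale M c (ract M m b)"
    and ract_scale_right: "ract M m (ascale B c b) = mscale M c (ract M m b)"
    and lact_lact: "lact M (amult A a a') m = lact M a (lact M a' m)"
    and ract_ract: "ract M m (amult B b b') = ract M (ract M m b) b'"
    and lact_ract: "lact M a (ract M m b) = ract M (lact M a m) b"
    and lact_one: "lact M (aone A) m = m"
    and ract_one: "ract M m (aone B) = m"

definition continuous_hom ::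
  "('k::real_normed_field, 'c::banach) alg \<Rightarrow> ('k, 'd::banach) alg \<Rightarrow> ('c \<Rightarrow> 'd) \<Rightarrow> bool" where
  "continuous_hom C D h \<longleftrightarrow>
     Vector_Spaces.linear (ascale C) (ascale D) h \<and> continuous_on UNIV h \<and>
     (\<forall>x y. h (amult C x y) = amult D (h x) (h y))"


section \<open>Triangular Banach algebras\<close>

text \<open>\<open>Tri a m b\<close> is the upper triangular matrix with diagonal entries \<open>a\<close>, \<open>b\<close> and corner entry \<open>m\<close>.\<close>

datatype ('a, 'm, 'b) tri = Tri (tri_a: 'a) (tri_m: 'm) (tri_b: 'b)

instantiation tri :: (real_normed_vector, real_normed_vector, real_normed_vector) real_normed_vector
begin

definition zero_tri :: "('a, 'b, 'c) tri" where
  "0 = Tri 0 0 0"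
definition plus_tri :: "('a, 'b, 'c) tri \<Rightarrow> ('a, 'b, 'c) tri \<Rightarrow> ('a, 'b, 'c) tri" where
  "x + y = Tri (tri_a x + tri_a y) (tri_m x + tri_m y) (tri_b x + tri_b y)"
definition minus_tri :: "('a, 'b, 'c) tri \<Rightarrow> ('a, 'b, 'c) tri \<Rightarrow> ('a, 'b, 'c) tri" where
  "x - y = Tri (tri_a x - tri_a y) (tri_m x - tri_m y) (tri_b x - tri_b y)"
definition uminus_tri :: "('a, 'b, 'c) tri \<Rightarrow> ('a, 'b, 'c) tri" where
  "- x = Tri (- tri_a x) (- tri_m x) (- tri_b x)"
definition scaleR_tri :: "real \<Rightarrow> ('a, 'b, 'c) tri \<Rightarrow> ('a, 'b, 'c) tri" where
  "r *\<^sub>R x = Tri (r *\<^sub>R tri_a x) (r *\<^sub>R tri_m x) (r *\<^sub>R tri_b x)"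
definition norm_tri :: "('a, 'b, 'c) tri \<Rightarrow> real" where
  "norm x = norm (tri_a x) + norm (tri_m x) + norm (tri_b x)"
definition sgn_tri :: "('a, 'b, 'c) tri \<Rightarrow> ('a, 'b, 'c) tri" where
  "sgn x = inverse (norm x) *\<^sub>R (x :: ('a, 'b, 'c) tri)"
definition dist_tri :: "('a, 'b, 'c) tri \<Rightarrow> ('a, 'b, 'c) tri \<Rightarrow> real" where
  "dist x y = norm (x - y :: ('a, 'b, 'c) tri)"
definition uniformity_tri :: "(('a, 'b, 'c) tri \<times> ('a, 'b, 'c) tri) filter" where
  "uniformity = (INF e\<in>{0 <..}. principal {(x :: ('a, 'b, 'c) tri, y). dist x y < e})"
definition open_tri :: "('a, 'b, 'c) tri set \<Rightarrow> bool" where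
  "open U \<longleftrightarrow> (\<forall>x\<in>U. \<forall>\<^sub>F (x', y) in uniformity. x' = (x :: ('a, 'b, 'c) tri) \<longrightarrow> y \<in> U)"

instance
proof
  fix x y z :: "('a, 'b, 'c) tri" and r s :: real
  show "norm (x + y) \<le> norm x + norm y"
    using norm_triangle_ineq[of "tri_a x" "tri_a y"] norm_triangle_ineq[of "tri_m x" "tri_m y"]
      norm_triangle_ineq[of "tri_b x" "tri_b y"]
    by (simp add: norm_tri_def plus_tri_def)
  show "norm x = 0 \<longleftrightarrow> x = 0"
    by (cases x) (auto simp: norm_tri_def zero_tri_def add_nonneg_eq_0_iff)
qed (auto simp: zero_tri_def plus_tri_def minus_tri_def uminus_tri_def scaleR_tri_def norm_tri_def
    sgn_tri_def dist_tri_def uniformity_tri_def open_tri_def scaleR_add_left scaleR_add_right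
    algebra_simps)

end

lemma tri_sel_simps [simp]:
  "tri_a 0 = 0" "tri_m 0 = 0" "tri_b 0 = 0"
  "tri_a (x + y) = tri_a x + tri_a y" "tri_m (x + y) = tri_m x + tri_m y"
  "tri_b (x + y) = tri_b x + tri_b y"
  "tri_a (x - y) = tri_a x - tri_a y" "tri_m (x - y) = tri_m x - tri_m y"
  "tri_b (x - y) = tri_b x - tri_b y"
  "tri_a (r *\<^sub>R x) = r *\<^sub>R tri_a x" "tri_m (r *\<^sub>R x) = r *\<^sub>R tri_m x"
  "tri_b (r *\<^sub>R x) = r *\<^sub>R tri_b x"
  by (simp_all add: zero_tri_def plus_tri_def minus_tri_def scaleR_tri_def)

instance tri :: (banach, banach, banach) banach
proof
  fix X :: "nat \<Rightarrow> ('a, 'b, 'c) tri"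
  assume X: "Cauchy X"
  have *: "Cauchy (\<lambda>n. f (X n))" if le: "\<And>x y. dist (f x) (f y) \<le> dist x y"
    for f :: "('a, 'b, 'c) tri \<Rightarrow> 'd::metric_space"
  proof (rule metric_CauchyI)
    fix e :: real
    assume "0 < e"
    then obtain N where N: "\<forall>m\<ge>N. \<forall>n\<ge>N. dist (X m) (X n) < e"
      using metric_CauchyD[OF X] by blast
    show "\<exists>N. \<forall>m\<ge>N. \<forall>n\<ge>N. dist (f (X m)) (f (X n)) < e"
      by (rule exI[of _ N]) (auto intro: le_less_trans[OF le] N[rule_format])
  qed
  have "Cauchy (\<lambda>n. tri_a (X n))" "Cauchy (\<lambda>n. tri_m (X n))" "Cauchy (\<lambda>n. tri_b (X n))"
    by (rule *[of tri_a] *[of tri_m] *[of tri_b]; simp add: dist_norm norm_tri_def)+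
  then obtain a m b where lim: "(\<lambda>n. tri_a (X n)) \<longlonglongrightarrow> a" "(\<lambda>n. tri_m (X n)) \<longlonglongrightarrow> m"
      "(\<lambda>n. tri_b (X n)) \<longlonglongrightarrow> b"
    unfolding Cauchy_convergent_iff convergent_def by blast
  have "(\<lambda>n. norm (X n - Tri a m b)) \<longlonglongrightarrow> 0 + 0 + 0"
    unfolding norm_tri_def tri_sel_simps tri.sel
    by (intro tendsto_add tendsto_norm_zero LIM_zero lim)
  then have "X \<longlonglongrightarrow> Tri a m b"
    using LIM_zero_cancel tendsto_norm_zero_cancel by fastforce
  then show "convergent X"
    by (rule convergentI)
qed

definition tri_alg ::
  "('k::real_normed_field, 'a::banach) alg \<Rightarrow> ('k, 'a, 'b, 'm::banach) bimod \<Rightarrow>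
   ('k, 'b::banach) alg \<Rightarrow> ('k, ('a, 'm, 'b) tri) alg" where
  "tri_alg A M B =
     \<lparr>ascale = (\<lambda>c x. Tri (ascale A c (tri_a x)) (mscale M c (tri_m x)) (ascale B c (tri_b x))),
      amult = (\<lambda>x y. Tri (amult A (tri_a x) (tri_a y))
        (lact M (tri_a x) (tri_m y) + ract M (tri_m x) (tri_b y)) (amult B (tri_b x) (tri_b y))),
      aone = Tri (aone A) 0 (aone B)\<rparr>"

text \<open>
  For contractive actions the triangular algebra is a Banach algebra in its own norm; in general
  its multiplication is still jointly continuous.
\<close>

lemma (in unital_banach_bimodule) bounded_bilinear_tri_mult:
  "bounded_bilinear (amult (tri_alg A M B))"
proof -
  interpret l: bounded_bilinear "lact M" by (rule bounded_bilinear_lact)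
  interpret r: bounded_bilinear "ract M" by (rule bounded_bilinear_ract)
  obtain K where K: "0 < K" "\<And>a m. norm (lact M a m) \<le> norm a * norm m * K"
    using l.pos_bounded by blast
  obtain L where L: "0 < L" "\<And>m b. norm (ract M m b) \<le> norm m * norm b * L"
    using r.pos_bounded by blast
  have sR: "r *\<^sub>R a = ascale A (of_real r) a" "r *\<^sub>R b = ascale B (of_real r) b" for r a b
    by (simp_all add: A.scale_of_real B.scale_of_real)
  have bnd: "norm (amult (tri_alg A M B) x y) \<le> norm x * norm y * (1 + K + L)" for x y
  proof -
    obtain a m b a' m' b' where xy: "x = Tri a m b" "y = Tri a' m' b'" by (metis tri.exhaust)
    have le: "norm a * norm a' \<le> norm x * norm y" "norm a * norm m' \<le> norm x * norm y"
      "norm m * norm b' \<le> norm x * norm y"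
      by (auto simp: xy norm_tri_def intro!: mult_mono)
    have "norm (amult (tri_alg A M B) x y) \<le>
        (norm a * norm a' + norm b * norm b') + norm a * norm m' * K + norm m * norm b' * L"
      using A.norm_mult[of a a'] B.norm_mult[of b b'] K(2)[of a m'] L(2)[of m b']
        norm_triangle_ineq[of "lact M a m'" "ract M m b'"]
      by (simp add: norm_tri_def tri_alg_def xy)
    also have "\<dots> \<le> norm x * norm y + norm x * norm y * K + norm x * norm y * L"
      using le K(1) L(1)
      by (intro add_mono mult_right_mono) (auto simp: xy norm_tri_def algebra_simps)
    finally show ?thesis by (simp add: algebra_simps)
  qed
  show ?thesis
  proof
    show "\<exists>K. \<forall>x y. norm (amult (tri_alg A M B) x y) \<le> norm x * norm y * K"
      using bnd by blast
  qed (auto simp: tri_alg_def plus_tri_def scaleR_tri_def A.mult_add_left A.mult_add_right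
      B.mult_add_left B.mult_add_right l.add_left l.add_right r.add_left r.add_right
      l.scaleR_left l.scaleR_right r.scaleR_left r.scaleR_right sR A.mult_scale_left
      A.mult_scale_right B.mult_scale_left B.mult_scale_right lact_scale_left ract_scale_right
      scale_of_real scaleR_add_right)
qed

lemma (in unital_banach_bimodule) unital_banach_algebra_tri:
  assumes "\<And>a m. norm (lact M a m) \<le> norm a * norm m"
    and "\<And>m b. norm (ract M m b) \<le> norm m * norm b"
  shows "unital_banach_algebra (tri_alg A M B)"
proof -
  interpret l: bounded_bilinear "lact M" by (rule bounded_bilinear_lact)
  interpret r: bounded_bilinear "ract M" by (rule bounded_bilinear_ract)
  show ?thesis
  proof (unfold_locales, goal_cases)
    case (14 x y)
    obtain a m b a' m' b' where xy: "x = Tri a m b" "y = Tri a' m' b'" by (metis tri.exhaust)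
    have "norm (amult (tri_alg A M B) x y) \<le>
        norm a * norm a' + (norm a * norm m' + norm m * norm b') + norm b * norm b'"
      using A.norm_mult[of a a'] B.norm_mult[of b b'] assms(1)[of a m'] assms(2)[of m b']
        norm_triangle_ineq[of "lact M a m'" "ract M m b'"]
      by (simp add: norm_tri_def tri_alg_def xy)
    also have "\<dots> \<le> norm x * norm y"
      by (simp add: xy norm_tri_def algebra_simps)
    finally show ?case .
  qed (simp_all add: tri_alg_def plus_tri_def scaleR_tri_def norm_tri_def A.mult_add_left
      A.mult_add_right B.mult_add_left B.mult_add_right l.add_left l.add_right r.add_left r.add_right
      l.zero_right r.zero_left A.mult_scale_left A.mult_scale_right B.mult_scale_left
      B.mult_scale_right A.scale_right_distrib B.scale_right_distrib scale_right_distrib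
      A.scale_left_distrib B.scale_left_distrib scale_left_distrib A.norm_scale B.norm_scale
      norm_scale A.scale_of_real B.scale_of_real scale_of_real A.mult_assoc B.mult_assoc lact_lact
      ract_ract lact_ract lact_one ract_one A.mult_one_left A.mult_one_right B.mult_one_left
      B.mult_one_right lact_scale_left lact_scale_right ract_scale_left ract_scale_right
      distrib_left add_ac)
qed

text \<open>
  The restrictions of an endomorphism \<open>h\<close> of the triangular algebra to the two diagonal corners,
  read through the identifications of \<open>a\<close> with \<open>Tri a 0 0\<close> and of \<open>b\<close> with \<open>Tri 0 0 b\<close>.  They are
  restrictions proper when \<open>h\<close> fixes the two diagonal idempotents.
\<close>

definition restr_a :: "(('a::zero, 'm::zero, 'b::zero) tri \<Rightarrow> ('a, 'm, 'b) tri) \<Rightarrow> 'a \<Rightarrow> 'a" where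
  "restr_a h a = tri_a (h (Tri a 0 0))"

definition restr_b :: "(('a::zero, 'm::zero, 'b::zero) tri \<Rightarrow> ('a, 'm, 'b) tri) \<Rightarrow> 'b \<Rightarrow> 'b" where
  "restr_b h b = tri_b (h (Tri 0 0 b))"

lemma (in unital_banach_bimodule)
  assumes h: "continuous_hom (tri_alg A M B) (tri_alg A M B) h"
  shows restr_a: "h (Tri (aone A) 0 0) = Tri (aone A) 0 0 \<Longrightarrow>
      h (Tri a 0 0) = Tri (restr_a h a) 0 0"
    and restr_b: "h (Tri 0 0 (aone B)) = Tri 0 0 (aone B) \<Longrightarrow>
      h (Tri 0 0 b) = Tri 0 0 (restr_b h b)"
proof -
  let ?mult = "amult (tri_alg A M B)"
  interpret l: bounded_bilinear "lact M" by (rule bounded_bilinear_lact)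
  interpret r: bounded_bilinear "ract M" by (rule bounded_bilinear_ract)
  have mA: "amult A 0 x = 0" "amult A x 0 = 0" for x
    using A.mult_add_left[of 0 0 x] A.mult_add_right[of x 0 0] by simp_all
  have mB: "amult B 0 x = 0" "amult B x 0 = 0" for x
    using B.mult_add_left[of 0 0 x] B.mult_add_right[of x 0 0] by simp_all
  note simps = tri_alg_def mA mB l.zero_left l.zero_right r.zero_left r.zero_right
    A.mult_one_left A.mult_one_right B.mult_one_left B.mult_one_right lact_one ract_one
  have mult: "h (?mult x y) = ?mult (h x) (h y)" for x y
    using h by (simp add: continuous_hom_def)
  {
    assume e: "h (Tri (aone A) 0 0) = Tri (aone A) 0 0"
    have "?mult (?mult (Tri (aone A) 0 0) (Tri a 0 0)) (Tri (aone A) 0 0) = Tri a 0 0"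
      by (simp add: simps)
    then have "h (Tri a 0 0) = ?mult (?mult (Tri (aone A) 0 0) (h (Tri a 0 0))) (Tri (aone A) 0 0)"
      by (metis mult e)
    then show "h (Tri a 0 0) = Tri (restr_a h a) 0 0"
      unfolding restr_a_def by (cases "h (Tri a 0 0)") (simp add: simps)
  next
    assume e: "h (Tri 0 0 (aone B)) = Tri 0 0 (aone B)"
    have "?mult (?mult (Tri 0 0 (aone B)) (Tri 0 0 b)) (Tri 0 0 (aone B)) = Tri 0 0 b"
      by (simp add: simps)
    then have "h (Tri 0 0 b) = ?mult (?mult (Tri 0 0 (aone B)) (h (Tri 0 0 b))) (Tri 0 0 (aone B))"
      by (metis mult e)
    then show "h (Tri 0 0 b) = Tri 0 0 (restr_b h b)"
      unfolding restr_b_def by (cases "h (Tri 0 0 b)") (simp add: simps)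
  }
qed


section \<open>The dual bimodule\<close>

text \<open>
  The type \<open>'c \<Rightarrow>\<^sub>L 'k\<close> consists of the bounded real-linear maps; the dual space is its subset of
  maps that are linear over \<open>'k\<close>.  Bimodules whose underlying set is a subset of a type carry that
  set in the field \<open>elems\<close>.
\<close>

record ('k, 'a, 'b, 'm) sub_bimod = "('k, 'a, 'b, 'm) bimod" +
  elems :: "'m set"

definition dual ::
  "('k::real_normed_field, 'c::banach) alg \<Rightarrow> ('k, 'c, 'c, 'c \<Rightarrow>\<^sub>L 'k) sub_bimod" where
  "dual C =
     \<lparr>mscale = (\<lambda>k f. Blinfun (\<lambda>s. k * blinfun_apply f s)),
      lact = (\<lambda>c f. Blinfun (\<lambda>s. blinfun_apply f (amult C s c))),
      ract = (\<lambda>f c. Blinfun (\<lambda>s. blinfun_apply f (amult C c s))),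
      elems = {f. Vector_Spaces.linear (ascale C) (*) (blinfun_apply f)}\<rparr>"

text \<open>The arguments of \<^const>\<open>Blinfun\<close> above are indeed bounded linear.\<close>

lemma dual_apply:
  "blinfun_apply (mscale (dual C) k f) s = k * blinfun_apply f s"
  "bounded_bilinear (amult C) \<Longrightarrow>
    blinfun_apply (lact (dual C) c f) s = blinfun_apply f (amult C s c)"
  "bounded_bilinear (amult C) \<Longrightarrow>
    blinfun_apply (ract (dual C) f c) s = blinfun_apply f (amult C c s)"
  by (simp_all add: dual_def bounded_linear_Blinfun_apply bounded_linear_const_mult
      bounded_linear_compose[OF blinfun.bounded_linear_right] blinfun.bounded_linear_right
      bounded_bilinear.bounded_linear_left bounded_bilinear.bounded_linear_right)

lemma (in unital_banach_algebra) bounded_bilinear_mult: "bounded_bilinear (amult A)"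
proof
  show "\<exists>K. \<forall>a b. norm (amult A a b) \<le> norm a * norm b * K"
    using norm_mult by (metis mult.right_neutral)
qed (simp_all add: mult_add_left mult_add_right flip: scale_of_real
    add: mult_scale_left mult_scale_right)


section \<open>Vector spaces given by a carrier set\<close>

record ('k, 'v) vec_space =
  vcarrier :: "'v set"
  vadd :: "'v \<Rightarrow> 'v \<Rightarrow> 'v"
  vscale :: "'k \<Rightarrow> 'v \<Rightarrow> 'v"

definition vquot :: "('k, 'v) vec_space \<Rightarrow> 'v set \<Rightarrow> ('k, 'v set) vec_space" where
  "vquot V W =
     \<lparr>vcarrier = {{vadd V x w |w. w \<in> W} |x. x \<in> vcarrier V},
      vadd = (\<lambda>X Y. {vadd V x y |x y. x \<in> X \<and> y \<in> Y}),
      vscale = (\<lambda>c X. {vadd V (vscale V c x) w |x w. x \<in> X \<and> w \<in> W})\<rparr>"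

definition vdirect_sum ::
  "('k, 'v) vec_space \<Rightarrow> ('k, 'w) vec_space \<Rightarrow> ('k, 'v \<times> 'w) vec_space" where
  "vdirect_sum V W =
     \<lparr>vcarrier = vcarrier V \<times> vcarrier W,
      vadd = (\<lambda>(v, w) (v', w'). (vadd V v v', vadd W w w')),
      vscale = (\<lambda>c (v, w). (vscale V c v, vscale W c w))\<rparr>"

definition visomorphic :: "('k, 'v) vec_space \<Rightarrow> ('k, 'w) vec_space \<Rightarrow> bool" where
  "visomorphic V W \<longleftrightarrow>
     (\<exists>f. bij_betw f (vcarrier V) (vcarrier W) \<and>
        (\<forall>x\<in>vcarrier V. \<forall>y\<in>vcarrier V. f (vadd V x y) = vadd W (f x) (f y)) \<and>
        (\<forall>c. \<forall>x\<in>vcarrier V. f (vscale V c x) = vscale W c (f x)))"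


section \<open>Twisted derivations and first cohomology\<close>

definition twisted_derivation ::
  "('k::real_normed_field, 'c::banach) alg \<Rightarrow> ('k, 'c, 'c, 'e::real_normed_vector) sub_bimod \<Rightarrow>
   ('c \<Rightarrow> 'c) \<Rightarrow> ('c \<Rightarrow> 'c) \<Rightarrow> ('c \<Rightarrow> 'e) \<Rightarrow> bool" where
  "twisted_derivation C E \<sigma> \<tau> d \<longleftrightarrow>
     range d \<subseteq> elems E \<and> Vector_Spaces.linear (ascale C) (mscale E) d \<and>
     (\<forall>a b. d (amult C a b) = ract E (d a) (\<sigma> b) + lact E (\<tau> a) (d b))"

definition twisted_inner ::
  "('k::real_normed_field, 'c::banach) alg \<Rightarrow> ('k, 'c, 'c, 'e::real_normed_vector) sub_bimod \<Rightarrow>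
   ('c \<Rightarrow> 'c) \<Rightarrow> ('c \<Rightarrow> 'c) \<Rightarrow> ('c \<Rightarrow> 'e) \<Rightarrow> bool" where
  "twisted_inner C E \<sigma> \<tau> d \<longleftrightarrow>
     (\<exists>x\<in>elems E. \<forall>a. d a = lact E (\<tau> a) x - ract E x (\<sigma> a))"

definition Z1 ::
  "('k::real_normed_field, 'c::banach) alg \<Rightarrow> ('k, 'c, 'c, 'e::real_normed_vector) sub_bimod \<Rightarrow>
   ('c \<Rightarrow> 'c) \<Rightarrow> ('c \<Rightarrow> 'c) \<Rightarrow> ('k, 'c \<Rightarrow> 'e) vec_space" where
  "Z1 C E \<sigma> \<tau> =
     \<lparr>vcarrier = {d. twisted_derivation C E \<sigma> \<tau> d \<and> continuous_on UNIV d},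
      vadd = (\<lambda>d d' a. d a + d' a),
      vscale = (\<lambda>c d a. mscale E c (d a))\<rparr>"

definition B1 ::
  "('k::real_normed_field, 'c::banach) alg \<Rightarrow> ('k, 'c, 'c, 'e::real_normed_vector) sub_bimod \<Rightarrow>
   ('c \<Rightarrow> 'c) \<Rightarrow> ('c \<Rightarrow> 'c) \<Rightarrow> ('c \<Rightarrow> 'e) set" where
  "B1 C E \<sigma> \<tau> = {d \<in> vcarrier (Z1 C E \<sigma> \<tau>). twisted_inner C E \<sigma> \<tau> d}"

definition H1 ::
  "('k::real_normed_field, 'c::banach) alg \<Rightarrow> ('k, 'c, 'c, 'e::real_normed_vector) sub_bimod \<Rightarrow>
   ('c \<Rightarrow> 'c) \<Rightarrow> ('c \<Rightarrow> 'c) \<Rightarrow> ('k, ('c \<Rightarrow> 'e) set) vec_space" where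
  "H1 C E \<sigma> \<tau> = vquot (Z1 C E \<sigma> \<tau>) (B1 C E \<sigma> \<tau>)"

end

theory Submission
  imports Defs "HOL-Library.Function_Algebras"
begin

text \<open>
  First cohomology with coefficients in the dual is contravariantly functorial: if a continuous
  homomorphism \<open>h\<close> from \<open>C\<close> to \<open>D\<close> intertwines the twisting maps, then \<open>d \<mapsto> (x \<mapsto> d (h x) \<circ> h)\<close>
  carries twisted derivations of \<open>D\<close> to twisted derivations of \<open>C\<close>, and inner ones to inner ones
  (\<open>pullback_in_Z1\<close>, \<open>twisted_inner_pullback\<close>).  For a triangular algebra \<open>T\<close> the inclusions of the
  diagonal corners \<open>A\<close>, \<open>B\<close> and also the projections onto them are homomorphisms.  The projections
  intertwine because an endomorphism fixing both diagonal idempotents preserves the Peirce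
  decomposition of \<open>T\<close>.  Pulling back along the inclusions restricts a derivation of \<open>T\<close> to the two
  corners; pulling back along the projections is a right inverse of this restriction.

  What remains is that the corner of \<open>T\<close> contributes no cohomology
  (\<open>twisted_inner_dual_minus_corners\<close>): a derivation \<open>d\<close> differs from the one rebuilt from its two
  restrictions by an inner derivation.  With \<open>e\<close> the idempotent of \<open>A\<close>, the nine Peirce components
  of the bilinear form \<open>d x s\<close> are computed from the product rule for \<open>e y\<close> and \<open>y e\<close>.  Apart
  from the two diagonal ones, they are zero or values of \<open>d e\<close> on the corner, and together they
  form the inner derivation given by the functional \<open>s \<mapsto> - d e (corner of s)\<close>.

  So a derivation of \<open>T\<close> is inner exactly when both restrictions are, and every pair of derivations
  of \<open>A\<close> and \<open>B\<close> is a pair of restrictions.  An abstract statement on quotients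
  (\<open>visomorphic_vquot_direct_sum\<close>) turns this into the isomorphism.
\<close>

section \<open>Isomorphisms between quotients\<close>

text \<open>
  This is the first isomorphism theorem for the map \<open>(r1, r2)\<close> from \<open>V\<close> onto \<open>W1 \<oplus> W2\<close>, under which
  \<open>U\<close> is the preimage of \<open>S1 \<oplus> S2\<close>.  Since \<open>r1\<close> and \<open>r2\<close> map \<open>U\<close> onto \<open>S1\<close> and \<open>S2\<close>, they map cosets
  onto cosets, so the isomorphism is simply \<open>X \<mapsto> (r1 ` X, r2 ` X)\<close>.
\<close>

lemma visomorphic_vquot_direct_sum:
  fixes V :: "('k, 'v::ab_group_add) vec_space"
    and W1 :: "('k, 'w1::ab_group_add) vec_space" and W2 :: "('k, 'w2::ab_group_add) vec_space"
    and r1 :: "'v \<Rightarrow> 'w1" and r2 :: "'v \<Rightarrow> 'w2"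
  assumes vadd: "vadd V = (+)" "vadd W1 = (+)" "vadd W2 = (+)"
    and add: "\<And>x y. r1 (x + y) = r1 x + r1 y" "\<And>x y. r2 (x + y) = r2 x + r2 y"
    and scale: "\<And>c x. r1 (vscale V c x) = vscale W1 c (r1 x)"
      "\<And>c x. r2 (vscale V c x) = vscale W2 c (r2 x)"
    and V_diff: "\<And>x y. x \<in> vcarrier V \<Longrightarrow> y \<in> vcarrier V \<Longrightarrow> x - y \<in> vcarrier V"
    and into: "r1 ` vcarrier V \<subseteq> vcarrier W1" "r2 ` vcarrier V \<subseteq> vcarrier W2"
    and onto: "\<And>y z. y \<in> vcarrier W1 \<Longrightarrow> z \<in> vcarrier W2 \<Longrightarrow> \<exists>x\<in>vcarrier V. r1 x = y \<and> r2 x = z"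
    and sub: "U \<subseteq> vcarrier V" "S1 \<subseteq> vcarrier W1" "S2 \<subseteq> vcarrier W2"
    and zero: "0 \<in> S1" "0 \<in> S2"
    and diff: "\<And>x y. x \<in> S1 \<Longrightarrow> y \<in> S1 \<Longrightarrow> x - y \<in> S1"
      "\<And>x y. x \<in> S2 \<Longrightarrow> y \<in> S2 \<Longrightarrow> x - y \<in> S2"
    and U_iff: "\<And>x. x \<in> vcarrier V \<Longrightarrow> x \<in> U \<longleftrightarrow> r1 x \<in> S1 \<and> r2 x \<in> S2"
  shows "visomorphic (vquot V U) (vdirect_sum (vquot W1 S1) (vquot W2 S2))"
proof -
  interpret r1: Modules.additive r1 by standard (rule add)
  interpret r2: Modules.additive r2 by standard (rule add)
  define f where "f X = (r1 ` X, r2 ` X)" for X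
  \<comment> \<open>A preimage of \<open>(y, 0)\<close> lies in \<open>U\<close> if \<open>y\<close> is in \<open>S1\<close>; likewise for \<open>S2\<close>.\<close>
  have img: "r1 ` U = S1" "r2 ` U = S2"
    using U_iff onto[OF _ subsetD[OF sub(3) zero(2)]] onto[OF subsetD[OF sub(2) zero(1)]] sub zero
    by (auto simp: image_iff subset_iff) metis+
  have f_coset: "f {x + w |w. w \<in> U} = ({r1 x + w |w. w \<in> S1}, {r2 x + w |w. w \<in> S2})" for x
    unfolding f_def img[symmetric] by (force simp: add)
  have coset_eqD: "x - y \<in> S" if "{x + w |w. w \<in> S} = {y + w |w. w \<in> S}" "0 \<in> S"
    for S and x y :: "'z::ab_group_add"
  proof -
    have "x \<in> {y + w |w. w \<in> S}"
      unfolding that(1)[symmetric] using that(2) by (auto intro: exI[of _ 0])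
    then show ?thesis by auto
  qed
  have U_diff: "x - y \<in> U" if "x \<in> U" "y \<in> U" for x y
  proof -
    have "x \<in> vcarrier V" "y \<in> vcarrier V"
      using that sub(1) by auto
    then show ?thesis
      using that U_iff V_diff diff by (auto simp: r1.diff r2.diff)
  qed
  have U0: "0 \<in> U"
    using U_diff img zero by fastforce
  have coset_eqI: "{x + w |w. w \<in> U} = {y + w |w. w \<in> U}" if "x - y \<in> U" for x y
  proof -
    have *: "{x + w |w. w \<in> U} \<subseteq> {y + w |w. w \<in> U}" if xy: "x - y \<in> U" for x y
    proof clarify
      fix w assume "w \<in> U"
      then have "(x - y) - (0 - w) \<in> U"
        using xy U_diff U0 by blast
      then show "\<exists>w'. x + w = y + w' \<and> w' \<in> U"
        by (intro exI[of _ "(x - y) - (0 - w)"]) simp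
    qed
    moreover have "y - x \<in> U"
      using U_diff[OF U0 that] by simp
    ultimately show ?thesis
      using that by blast
  qed
  have f_inj: "inj_on f (vcarrier (vquot V U))"
  proof (rule inj_onI)
    fix X Y
    assume "X \<in> vcarrier (vquot V U)" "Y \<in> vcarrier (vquot V U)" and eq: "f X = f Y"
    then obtain x y where x: "x \<in> vcarrier V" "X = {x + w |w. w \<in> U}"
      and y: "y \<in> vcarrier V" "Y = {y + w |w. w \<in> U}"
      by (auto simp: vquot_def vadd)
    have "r1 x - r1 y \<in> S1" "r2 x - r2 y \<in> S2"
      using eq zero unfolding x y f_coset by (auto intro!: coset_eqD)
    then have "x - y \<in> U"
      using U_iff[of "x - y"] V_diff x y by (simp add: r1.diff r2.diff)
    then show "X = Y"
      unfolding x y by (rule coset_eqI)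
  qed
  have f_onto: "f ` vcarrier (vquot V U) = vcarrier (vdirect_sum (vquot W1 S1) (vquot W2 S2))"
  proof (intro equalityI subsetI)
    fix Z
    assume "Z \<in> f ` vcarrier (vquot V U)"
    then obtain x where x: "x \<in> vcarrier V"
      "Z = ({r1 x + w |w. w \<in> S1}, {r2 x + w |w. w \<in> S2})"
      by (auto simp: vquot_def vadd f_coset)
    then have "r1 x \<in> vcarrier W1" "r2 x \<in> vcarrier W2"
      using into by auto
    then show "Z \<in> vcarrier (vdirect_sum (vquot W1 S1) (vquot W2 S2))"
      unfolding vquot_def vdirect_sum_def vadd x(2) by auto
  next
    fix Z
    assume "Z \<in> vcarrier (vdirect_sum (vquot W1 S1) (vquot W2 S2))"
    then obtain y z where yz: "y \<in> vcarrier W1" "z \<in> vcarrier W2"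
      "Z = ({y + w |w. w \<in> S1}, {z + w |w. w \<in> S2})"
      by (auto simp: vquot_def vdirect_sum_def vadd)
    then obtain x where "x \<in> vcarrier V" "r1 x = y" "r2 x = z"
      using onto by blast
    then have "x \<in> vcarrier V" "Z = f {x + w |w. w \<in> U}"
      by (simp_all add: yz f_coset)
    then show "Z \<in> f ` vcarrier (vquot V U)"
      by (auto simp: vquot_def vadd)
  qed
  \<comment> \<open>Sums and scalar multiples of cosets are sets of this shape, so compatibility of the two
    restrictions with the operations on elements passes to cosets.\<close>
  have image: "g ` {h x y |x y. x \<in> X \<and> y \<in> Y} = {h' u v |u v. u \<in> g ` X \<and> v \<in> g ` Y}"
    if "\<And>x y. g (h x y) = h' (g x) (g y)" for g :: "'v \<Rightarrow> 'z" and h h' X Y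
  proof (intro equalityI subsetI)
    fix z
    assume "z \<in> {h' u v |u v. u \<in> g ` X \<and> v \<in> g ` Y}"
    then obtain x y where "x \<in> X" "y \<in> Y" "z = h' (g x) (g y)"
      by blast
    then have "x \<in> X" "y \<in> Y" "z = g (h x y)"
      by (simp_all add: that)
    then show "z \<in> g ` {h x y |x y. x \<in> X \<and> y \<in> Y}"
      by blast
  qed (clarsimp simp: that, blast)
  have f_add: "f (vadd (vquot V U) X Y) =
      vadd (vdirect_sum (vquot W1 S1) (vquot W2 S2)) (f X) (f Y)" for X Y
    unfolding f_def vquot_def vdirect_sum_def vadd
    by (simp add: image[of r1 "(+)" "(+)", OF add(1)] image[of r2 "(+)" "(+)", OF add(2)])
  have f_scale: "f (vscale (vquot V U) c X) =
      vscale (vdirect_sum (vquot W1 S1) (vquot W2 S2)) c (f X)" for c X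
  proof -
    have "r1 ` {vscale V c x + w |x w. x \<in> X \<and> w \<in> U} =
        {vscale W1 c y + w |y w. y \<in> r1 ` X \<and> w \<in> r1 ` U}"
      "r2 ` {vscale V c x + w |x w. x \<in> X \<and> w \<in> U} =
        {vscale W2 c z + w |z w. z \<in> r2 ` X \<and> w \<in> r2 ` U}"
      by (rule image; simp only: add scale)+
    then show ?thesis
      unfolding f_def vquot_def vdirect_sum_def vadd img by simp
  qed
  show ?thesis
    unfolding visomorphic_def bij_betw_def
    by (intro exI[of _ f] conjI ballI allI f_inj f_onto f_add f_scale)
qed


section \<open>Twisted derivations into the dual bimodule\<close>

lemma vadd_Z1: "vadd (Z1 C E \<sigma> \<tau>) = (+)"
  by (intro ext) (simp add: Z1_def)

lemma B1_subset_Z1: "B1 C E \<sigma> \<tau> \<subseteq> vcarrier (Z1 C E \<sigma> \<tau>)"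
  by (auto simp: B1_def)

lemma blinfun_eq_iff: "f = g \<longleftrightarrow> (\<forall>x. blinfun_apply f x = blinfun_apply g x)"
  by (auto intro: blinfun_eqI)

text \<open>
  If the module actions are not contractive, a triangular algebra need not satisfy the norm
  inequality of a Banach algebra.  Joint continuity of the multiplication suffices for the theory of
  derivations into the dual, and it covers the triangular algebra and its two corners alike.
\<close>

locale continuous_algebra =
  fixes C :: "('k::real_normed_field, 'c::banach) alg"
  assumes vector_space: "vector_space (ascale C)"
    and bounded_bilinear: "bounded_bilinear (amult C)"
    and assoc: "amult C (amult C x y) z = amult C x (amult C y z)"
begin

lemma vector_space_dual: "vector_space (mscale (dual C))"
  by standard (auto intro!: blinfun_eqI simp: dual_apply blinfun.bilinear_simps algebra_simps)

lemma elems_dual: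
  "elems (dual C) = {f. Vector_Spaces.linear (ascale C) (*) (blinfun_apply f)}"
  by (simp add: dual_def)

text \<open>
  Evaluating functionals turns a derivation \<open>d\<close> into the scalar-valued form \<open>(x, s) \<mapsto> d x s\<close>.  All
  later computations take place in this form, where the module actions have disappeared.
\<close>

lemma twisted_derivation_dual_iff:
  "twisted_derivation C (dual C) \<sigma> \<tau> d \<longleftrightarrow>
    (\<forall>x. Vector_Spaces.linear (ascale C) (*) (blinfun_apply (d x))) \<and>
    (\<forall>s. Vector_Spaces.linear (ascale C) (*) (\<lambda>x. blinfun_apply (d x) s)) \<and>
    (\<forall>x y s. blinfun_apply (d (amult C x y)) s =
      blinfun_apply (d x) (amult C (\<sigma> y) s) + blinfun_apply (d y) (amult C s (\<tau> x)))"
proof -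
  have "vector_space ((*) :: 'k \<Rightarrow> 'k \<Rightarrow> 'k)"
    by standard (auto simp: algebra_simps)
  then have "Vector_Spaces.linear (ascale C) (mscale (dual C)) d \<longleftrightarrow>
      (\<forall>s. Vector_Spaces.linear (ascale C) (*) (\<lambda>x. blinfun_apply (d x) s))"
    using vector_space vector_space_dual
    by (auto simp: Vector_Spaces.linear_iff blinfun_eq_iff dual_apply blinfun.add_left)
  moreover have "d (amult C x y) = ract (dual C) (d x) (\<sigma> y) + lact (dual C) (\<tau> x) (d y) \<longleftrightarrow>
      (\<forall>s. blinfun_apply (d (amult C x y)) s =
        blinfun_apply (d x) (amult C (\<sigma> y) s) + blinfun_apply (d y) (amult C s (\<tau> x)))" for x y
    by (simp add: blinfun_eq_iff dual_apply bounded_bilinear blinfun.add_left)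
  ultimately show ?thesis
    by (simp add: twisted_derivation_def elems_dual image_subset_iff)
qed

lemma twisted_inner_dual_iff:
  "twisted_inner C (dual C) \<sigma> \<tau> d \<longleftrightarrow>
    (\<exists>\<psi>. Vector_Spaces.linear (ascale C) (*) (blinfun_apply \<psi>) \<and>
      (\<forall>x s. blinfun_apply (d x) s =
        blinfun_apply \<psi> (amult C s (\<tau> x)) - blinfun_apply \<psi> (amult C (\<sigma> x) s)))"
proof -
  have "d x = lact (dual C) (\<tau> x) \<psi> - ract (dual C) \<psi> (\<sigma> x) \<longleftrightarrow>
      (\<forall>s. blinfun_apply (d x) s =
        blinfun_apply \<psi> (amult C s (\<tau> x)) - blinfun_apply \<psi> (amult C (\<sigma> x) s))" for x \<psi>
    by (simp add: blinfun_eq_iff dual_apply bounded_bilinear blinfun.diff_left)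
  then show ?thesis
    by (auto simp: twisted_inner_def elems_dual)
qed

lemma Z1_dual_add:
  "d + d' \<in> vcarrier (Z1 C (dual C) \<sigma> \<tau>)"
  if "d \<in> vcarrier (Z1 C (dual C) \<sigma> \<tau>)" "d' \<in> vcarrier (Z1 C (dual C) \<sigma> \<tau>)"
  using that
  by (auto simp: Z1_def twisted_derivation_dual_iff Vector_Spaces.linear_iff blinfun.bilinear_simps
      algebra_simps plus_fun_def intro: continuous_on_add)

lemma Z1_dual_diff:
  "d - d' \<in> vcarrier (Z1 C (dual C) \<sigma> \<tau>)"
  if "d \<in> vcarrier (Z1 C (dual C) \<sigma> \<tau>)" "d' \<in> vcarrier (Z1 C (dual C) \<sigma> \<tau>)"
  using that
  by (auto simp: Z1_def twisted_derivation_dual_iff Vector_Spaces.linear_iff blinfun.bilinear_simps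
      algebra_simps fun_diff_def intro: continuous_on_diff)

lemma twisted_inner_dual_add:
  assumes "twisted_inner C (dual C) \<sigma> \<tau> d" "twisted_inner C (dual C) \<sigma> \<tau> d'"
  shows "twisted_inner C (dual C) \<sigma> \<tau> (d + d')"
proof -
  obtain \<psi> \<psi>' where
    "Vector_Spaces.linear (ascale C) (*) (blinfun_apply \<psi>)"
    "Vector_Spaces.linear (ascale C) (*) (blinfun_apply \<psi>')"
    "\<And>x s. blinfun_apply (d x) s =
        blinfun_apply \<psi> (amult C s (\<tau> x)) - blinfun_apply \<psi> (amult C (\<sigma> x) s)"
    "\<And>x s. blinfun_apply (d' x) s =
        blinfun_apply \<psi>' (amult C s (\<tau> x)) - blinfun_apply \<psi>' (amult C (\<sigma> x) s)"
    using assms unfolding twisted_inner_dual_iff by blast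
  then show ?thesis
    unfolding twisted_inner_dual_iff
    by (intro exI[of _ "\<psi> + \<psi>'"])
      (simp add: Vector_Spaces.linear_iff blinfun.bilinear_simps distrib_left)
qed

lemma twisted_inner_dual_uminus:
  assumes "twisted_inner C (dual C) \<sigma> \<tau> d"
  shows "twisted_inner C (dual C) \<sigma> \<tau> (- d)"
proof -
  obtain \<psi> where
    "Vector_Spaces.linear (ascale C) (*) (blinfun_apply \<psi>)"
    "\<And>x s. blinfun_apply (d x) s =
        blinfun_apply \<psi> (amult C s (\<tau> x)) - blinfun_apply \<psi> (amult C (\<sigma> x) s)"
    using assms unfolding twisted_inner_dual_iff by blast
  then show ?thesis
    unfolding twisted_inner_dual_iff
    by (intro exI[of _ "- \<psi>"])
      (auto simp: Vector_Spaces.linear_iff blinfun.bilinear_simps algebra_simps)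
qed

lemma B1_dual_diff:
  "d - d' \<in> B1 C (dual C) \<sigma> \<tau>" if "d \<in> B1 C (dual C) \<sigma> \<tau>" "d' \<in> B1 C (dual C) \<sigma> \<tau>"
  using that Z1_dual_diff[of d \<sigma> \<tau> d'] twisted_inner_dual_add[of \<sigma> \<tau> d "- d'"]
    twisted_inner_dual_uminus[of \<sigma> \<tau> d']
  by (simp add: B1_def)

lemma zero_in_B1_dual: "0 \<in> B1 C (dual C) \<sigma> \<tau>"
proof -
  have lin: "Vector_Spaces.linear (ascale C) (*) (\<lambda>_. 0 :: 'k)"
    using vector_space by (auto simp: Vector_Spaces.linear_iff vector_space_def algebra_simps)
  have zero: "blinfun_apply (0 :: 'c \<Rightarrow>\<^sub>L 'k) = (\<lambda>_. 0)"
    by (simp add: fun_eq_iff)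
  have "twisted_inner C (dual C) \<sigma> \<tau> 0"
    unfolding twisted_inner_dual_iff by (intro exI[of _ 0]) (simp add: zero lin)
  moreover have "0 \<in> vcarrier (Z1 C (dual C) \<sigma> \<tau>)"
    by (simp add: Z1_def twisted_derivation_dual_iff zero_fun_def zero lin)
  ultimately show ?thesis
    by (simp add: B1_def)
qed

end

sublocale unital_banach_algebra \<subseteq> continuous_algebra A
  by (intro continuous_algebra.intro vector_space_axioms bounded_bilinear_mult mult_assoc)


section \<open>Pullback along homomorphisms\<close>

text \<open>
  A homomorphism is applied to both arguments of the form \<open>(x, s) \<mapsto> d x s\<close>, which is what keeps the
  result a derivation into the dual of the same algebra.
\<close>

definition pullback ::
  "('c::real_normed_vector \<Rightarrow> 'd::real_normed_vector) \<Rightarrow> ('d \<Rightarrow> 'd \<Rightarrow>\<^sub>L 'k::real_normed_field) \<Rightarrow>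
    'c \<Rightarrow> 'c \<Rightarrow>\<^sub>L 'k" where
  "pullback h d = (\<lambda>x. d (h x) o\<^sub>L Blinfun h)"

lemma pullback_apply:
  "bounded_linear h \<Longrightarrow> blinfun_apply (pullback h d x) s = blinfun_apply (d (h x)) (h s)"
  by (simp add: pullback_def bounded_linear_Blinfun_apply)

lemma pullback_add: "pullback h (d + d') = pullback h d + pullback h d'"
  by (auto simp: pullback_def fun_eq_iff intro!: blinfun_eqI simp: blinfun.bilinear_simps)

lemma pullback_scale:
  "pullback h (vscale (Z1 D (dual D) \<sigma>' \<tau>') c d) = vscale (Z1 C (dual C) \<sigma> \<tau>) c (pullback h d)"
  by (auto simp: pullback_def fun_eq_iff Z1_def dual_apply intro!: blinfun_eqI)

text \<open>
  Units do not enter the notion, because the inclusion of a diagonal corner into a triangular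
  algebra sends the unit of the corner only to an idempotent.
\<close>

locale intertwining_hom = C: continuous_algebra C + D: continuous_algebra D
  for C :: "('k::real_normed_field, 'c::banach) alg" and D :: "('k, 'd::banach) alg" +
  fixes \<sigma> \<tau> :: "'c \<Rightarrow> 'c" and \<sigma>' \<tau>' :: "'d \<Rightarrow> 'd" and h :: "'c \<Rightarrow> 'd"
  assumes bounded_linear: "bounded_linear h"
    and scale: "h (ascale C c x) = ascale D c (h x)"
    and mult: "h (amult C x y) = amult D (h x) (h y)"
    and intertwines: "h (\<sigma> x) = \<sigma>' (h x)" "h (\<tau> x) = \<tau>' (h x)"
begin

lemma add: "h (x + y) = h x + h y"
  using bounded_linear by (rule bounded_linear.linear[THEN linear_add])

lemma pullback_in_Z1:
  assumes "d \<in> vcarrier (Z1 D (dual D) \<sigma>' \<tau>')"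
  shows "pullback h d \<in> vcarrier (Z1 C (dual C) \<sigma> \<tau>)"
proof -
  have "continuous_on UNIV d"
    using assms by (simp add: Z1_def)
  then have "continuous_on UNIV (\<lambda>x. d (h x))"
    by (rule continuous_on_compose2) (auto intro: linear_continuous_on bounded_linear)
  then have "continuous_on UNIV (pullback h d)"
    unfolding pullback_def by (intro continuous_intros)
  moreover have "twisted_derivation C (dual C) \<sigma> \<tau> (pullback h d)"
    using assms C.vector_space
    by (auto simp: Z1_def C.twisted_derivation_dual_iff D.twisted_derivation_dual_iff
        Vector_Spaces.linear_iff pullback_apply[OF bounded_linear] add scale mult intertwines)
  ultimately show ?thesis
    by (simp add: Z1_def)
qed

text \<open>If \<open>\<psi>\<close> implements a derivation, then \<open>\<psi> \<circ> h\<close> implements its pullback.\<close>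

lemma twisted_inner_pullback:
  assumes "twisted_inner D (dual D) \<sigma>' \<tau>' d"
  shows "twisted_inner C (dual C) \<sigma> \<tau> (pullback h d)"
proof -
  obtain \<psi> where \<psi>: "Vector_Spaces.linear (ascale D) (*) (blinfun_apply \<psi>)"
    "\<And>x s. blinfun_apply (d x) s =
        blinfun_apply \<psi> (amult D s (\<tau>' x)) - blinfun_apply \<psi> (amult D (\<sigma>' x) s)"
    using assms unfolding D.twisted_inner_dual_iff by blast
  have "Vector_Spaces.linear (ascale C) (*) (blinfun_apply (\<psi> o\<^sub>L Blinfun h))"
    using \<psi>(1) C.vector_space
    by (auto simp: Vector_Spaces.linear_iff bounded_linear_Blinfun_apply bounded_linear add scale)
  then show ?thesis
    unfolding C.twisted_inner_dual_iff
    by (intro exI[of _ "\<psi> o\<^sub>L Blinfun h"])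
      (auto simp: pullback_apply[OF bounded_linear] bounded_linear_Blinfun_apply bounded_linear
        mult intertwines \<psi>(2))
qed

end


section \<open>Triangular algebras and their Peirce decomposition\<close>

lemma bounded_linear_tri_a: "bounded_linear tri_a"
  by (rule bounded_linear_intro[of _ 1]) (auto simp: norm_tri_def)

lemma bounded_linear_tri_b: "bounded_linear tri_b"
  by (rule bounded_linear_intro[of _ 1]) (auto simp: norm_tri_def)

lemma bounded_linear_Tri_a: "bounded_linear (\<lambda>a. Tri a 0 0)"
  by (rule bounded_linear_intro[of _ 1]) (auto simp: norm_tri_def plus_tri_def scaleR_tri_def)

lemma bounded_linear_Tri_b: "bounded_linear (\<lambda>b. Tri 0 0 b)"
  by (rule bounded_linear_intro[of _ 1]) (auto simp: norm_tri_def plus_tri_def scaleR_tri_def)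

lemma bounded_linear_corner: "bounded_linear (\<lambda>x. Tri 0 (tri_m x) 0)"
  by (rule bounded_linear_intro[of _ 1]) (auto simp: norm_tri_def plus_tri_def scaleR_tri_def)

context unital_banach_bimodule
begin

lemma tri_eq_iff: "(x = y) = (tri_a x = tri_a y \<and> tri_m x = tri_m y \<and> tri_b x = tri_b y)"
  by (cases x; cases y) simp

lemma mult_zero [simp]:
  "amult A 0 a = 0" "amult A a 0 = 0" "amult B 0 b = 0" "amult B b 0 = 0"
  using A.mult_add_left[of 0 0 a] A.mult_add_right[of a 0 0]
    B.mult_add_left[of 0 0 b] B.mult_add_right[of b 0 0] by simp_all

lemma act_zero [simp]:
  "lact M 0 m = 0" "lact M a 0 = 0" "ract M m 0 = 0" "ract M 0 b = 0"
  using bounded_bilinear.zero_left bounded_bilinear.zero_right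
    bounded_bilinear_lact bounded_bilinear_ract by blast+

lemma tri_alg_simps:
  "tri_a (amult (tri_alg A M B) x y) = amult A (tri_a x) (tri_a y)"
  "tri_m (amult (tri_alg A M B) x y) = lact M (tri_a x) (tri_m y) + ract M (tri_m x) (tri_b y)"
  "tri_b (amult (tri_alg A M B) x y) = amult B (tri_b x) (tri_b y)"
  "tri_a (ascale (tri_alg A M B) c x) = ascale A c (tri_a x)"
  "tri_m (ascale (tri_alg A M B) c x) = mscale M c (tri_m x)"
  "tri_b (ascale (tri_alg A M B) c x) = ascale B c (tri_b x)"
  by (simp_all add: tri_alg_def)

sublocale tri: continuous_algebra "tri_alg A M B"
proof (rule continuous_algebra.intro)
  interpret l: bounded_bilinear "lact M" by (rule bounded_bilinear_lact)
  interpret r: bounded_bilinear "ract M" by (rule bounded_bilinear_ract)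
  show "vector_space (ascale (tri_alg A M B))"
    by standard (simp_all add: tri_eq_iff tri_alg_simps A.scale_right_distrib B.scale_right_distrib
        scale_right_distrib A.scale_left_distrib B.scale_left_distrib scale_left_distrib)
  show "bounded_bilinear (amult (tri_alg A M B))"
    by (rule bounded_bilinear_tri_mult)
  show "amult (tri_alg A M B) (amult (tri_alg A M B) x y) z =
      amult (tri_alg A M B) x (amult (tri_alg A M B) y z)" for x y z
    by (simp add: tri_eq_iff tri_alg_simps A.mult_assoc B.mult_assoc lact_lact ract_ract lact_ract
        l.add_right r.add_left add_ac)
qed

end

locale triangular_endomorphism = unital_banach_bimodule A B M
  for A :: "('k::real_normed_field, 'a::banach) alg" and B :: "('k, 'b::banach) alg"
    and M :: "('k, 'a, 'b, 'm::banach) bimod" +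
  fixes \<sigma> :: "('a, 'm, 'b) tri \<Rightarrow> ('a, 'm, 'b) tri"
  assumes hom: "continuous_hom (tri_alg A M B) (tri_alg A M B) \<sigma>"
    and fix_a: "\<sigma> (Tri (aone A) 0 0) = Tri (aone A) 0 0"
    and fix_b: "\<sigma> (Tri 0 0 (aone B)) = Tri 0 0 (aone B)"
begin

lemma mult: "\<sigma> (amult (tri_alg A M B) x y) = amult (tri_alg A M B) (\<sigma> x) (\<sigma> y)"
  using hom by (simp add: continuous_hom_def)

lemma Tri_a: "\<sigma> (Tri a 0 0) = Tri (restr_a \<sigma> a) 0 0"
  using restr_a[OF hom fix_a] .

lemma Tri_b: "\<sigma> (Tri 0 0 b) = Tri 0 0 (restr_b \<sigma> b)"
  using restr_b[OF hom fix_b] .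

text \<open>
  Compressing \<open>x\<close> by the idempotent \<open>e\<close> of \<open>A\<close> extracts its diagonal entry, and \<open>\<sigma> (e x e) = e \<sigma>(x) e\<close>
  because \<open>\<sigma>\<close> fixes \<open>e\<close>.  Hence the projection to \<open>A\<close> intertwines \<open>\<sigma>\<close> with its restriction.
\<close>

lemma tri_a: "tri_a (\<sigma> x) = restr_a \<sigma> (tri_a x)"
proof -
  let ?e = "Tri (aone A) 0 0" and ?mult = "amult (tri_alg A M B)"
  have "?mult (?mult ?e x) ?e = Tri (tri_a x) 0 0"
    by (simp add: tri_eq_iff tri_alg_simps A.mult_one_left A.mult_one_right)
  then have "Tri (restr_a \<sigma> (tri_a x)) 0 0 = ?mult (?mult ?e (\<sigma> x)) ?e"
    by (metis Tri_a mult fix_a)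
  then show ?thesis
    by (simp add: tri_eq_iff tri_alg_simps A.mult_one_left A.mult_one_right)
qed

lemma tri_b: "tri_b (\<sigma> x) = restr_b \<sigma> (tri_b x)"
proof -
  let ?f = "Tri 0 0 (aone B)" and ?mult = "amult (tri_alg A M B)"
  have "?mult (?mult ?f x) ?f = Tri 0 0 (tri_b x)"
    by (simp add: tri_eq_iff tri_alg_simps B.mult_one_left B.mult_one_right)
  then have "Tri 0 0 (restr_b \<sigma> (tri_b x)) = ?mult (?mult ?f (\<sigma> x)) ?f"
    by (metis Tri_b mult fix_b)
  then show ?thesis
    by (simp add: tri_eq_iff tri_alg_simps B.mult_one_left B.mult_one_right)
qed

lemma restr_0: "restr_a \<sigma> 0 = 0" "restr_b \<sigma> 0 = 0"
proof -
  have "\<sigma> (0 + 0) = \<sigma> 0 + \<sigma> 0"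
    using hom unfolding continuous_hom_def Vector_Spaces.linear_iff by blast
  then show "restr_a \<sigma> 0 = 0" "restr_b \<sigma> 0 = 0"
    by (simp_all add: restr_a_def restr_b_def flip: zero_tri_def)
qed

text \<open>
  The diagonal entries of \<open>x\<close> are sent into the diagonal, so only the corner of \<open>x\<close> contributes to the
  corner of \<open>\<sigma> x\<close>.
\<close>

lemma tri_m: "tri_m (\<sigma> x) = tri_m (\<sigma> (Tri 0 (tri_m x) 0))"
proof -
  have add: "\<sigma> (y + z) = \<sigma> y + \<sigma> z" for y z
    using hom unfolding continuous_hom_def Vector_Spaces.linear_iff by blast
  have "x = Tri (tri_a x) 0 0 + Tri 0 (tri_m x) 0 + Tri 0 0 (tri_b x)"
    by (simp add: tri_eq_iff)
  from arg_cong[OF this, of \<sigma>]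
  have "\<sigma> x = \<sigma> (Tri (tri_a x) 0 0) + \<sigma> (Tri 0 (tri_m x) 0) + \<sigma> (Tri 0 0 (tri_b x))"
    by (simp only: add)
  from arg_cong[OF this, of tri.tri_m] show ?thesis
    by (simp add: Tri_a Tri_b)
qed

end

locale triangular_endomorphism_pair =
  \<sigma>: triangular_endomorphism A B M \<sigma> + \<tau>: triangular_endomorphism A B M \<tau>
  for A :: "('k::real_normed_field, 'a::banach) alg" and B :: "('k, 'b::banach) alg"
    and M :: "('k, 'a, 'b, 'm::banach) bimod" and \<sigma> \<tau> :: "('a, 'm, 'b) tri \<Rightarrow> ('a, 'm, 'b) tri"
begin

abbreviation "T \<equiv> tri_alg A M B"
abbreviation "in_a \<equiv> (\<lambda>a. Tri a 0 0 :: ('a, 'm, 'b) tri)"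
abbreviation "in_b \<equiv> (\<lambda>b. Tri 0 0 b :: ('a, 'm, 'b) tri)"

lemmas T_simps = \<sigma>.tri_eq_iff \<sigma>.tri_alg_simps \<sigma>.mult_zero \<sigma>.act_zero
  \<sigma>.A.mult_one_left \<sigma>.A.mult_one_right \<sigma>.B.mult_one_left \<sigma>.B.mult_one_right \<sigma>.lact_one \<sigma>.ract_one

sublocale in_a: intertwining_hom A T "restr_a \<sigma>" "restr_a \<tau>" \<sigma> \<tau> in_a
  by (intro intertwining_hom.intro intertwining_hom_axioms.intro
      \<sigma>.A.continuous_algebra_axioms \<sigma>.tri.continuous_algebra_axioms)
    (simp_all add: bounded_linear_Tri_a \<sigma>.Tri_a \<tau>.Tri_a T_simps)

sublocale in_b: intertwining_hom B T "restr_b \<sigma>" "restr_b \<tau>" \<sigma> \<tau> in_b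
  by (intro intertwining_hom.intro intertwining_hom_axioms.intro
      \<sigma>.B.continuous_algebra_axioms \<sigma>.tri.continuous_algebra_axioms)
    (simp_all add: bounded_linear_Tri_b \<sigma>.Tri_b \<tau>.Tri_b T_simps)

sublocale out_a: intertwining_hom T A \<sigma> \<tau> "restr_a \<sigma>" "restr_a \<tau>" tri_a
  by (intro intertwining_hom.intro intertwining_hom_axioms.intro
      \<sigma>.A.continuous_algebra_axioms \<sigma>.tri.continuous_algebra_axioms)
    (simp_all add: bounded_linear_tri_a \<sigma>.tri_a \<tau>.tri_a T_simps)

sublocale out_b: intertwining_hom T B \<sigma> \<tau> "restr_b \<sigma>" "restr_b \<tau>" tri_b
  by (intro intertwining_hom.intro intertwining_hom_axioms.intro
      \<sigma>.B.continuous_algebra_axioms \<sigma>.tri.continuous_algebra_axioms)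
    (simp_all add: bounded_linear_tri_b \<sigma>.tri_b \<tau>.tri_b T_simps)

text \<open>
  The corner contributes nothing because multiplication by \<open>e\<close> separates it from the diagonal:
  \<open>e m = m\<close> and \<open>m e = 0\<close> for \<open>m\<close> in the corner.  The product rule for \<open>e y\<close> and for \<open>y e\<close> then expresses
  every component of \<open>(x, s) \<mapsto> d x s\<close>, except those on \<open>A \<times> A\<close> and \<open>B \<times> B\<close>, through the single
  functional \<open>d e\<close>.
\<close>

lemma twisted_inner_dual_minus_corners:
  assumes "d \<in> vcarrier (Z1 T (dual T) \<sigma> \<tau>)"
  shows "twisted_inner T (dual T) \<sigma> \<tau>
    (d - (pullback tri_a (pullback in_a d) + pullback tri_b (pullback in_b d)))"
proof -
  let ?D = "\<lambda>x. blinfun_apply (d x)" and ?mult = "amult T"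
  define e where "e = in_a (aone A)"
  define corner where "corner m = (Tri 0 m 0 :: ('a, 'm, 'b) tri)" for m
  have D: "?D (?mult x y) s = ?D x (?mult (\<sigma> y) s) + ?D y (?mult s (\<tau> x))" for x y s
    using assms by (simp add: Z1_def \<sigma>.tri.twisted_derivation_dual_iff)
  have lin: "Vector_Spaces.linear (ascale T) (*) (?D x)" for x
    using assms by (simp add: Z1_def \<sigma>.tri.twisted_derivation_dual_iff)
  have add_x: "?D (x + y) s = ?D x s + ?D y s" for x y s
    using assms by (simp add: Z1_def \<sigma>.tri.twisted_derivation_dual_iff Vector_Spaces.linear_iff)
  have left: "?D (?mult e y) s = ?D e (?mult (\<sigma> y) s) + ?D y (?mult s e)" for y s
    using D[of e y s] by (simp add: e_def \<tau>.fix_a)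
  have right: "?D (?mult y e) s = ?D y (?mult e s) + ?D e (?mult s (\<tau> y))" for y s
    using D[of y e s] by (simp add: e_def \<sigma>.fix_a)
  have D0: "?D 0 s = 0" for s
    using add_x[of 0 0 s] by simp
  note [simp] = blinfun.zero_right zero_tri_def[symmetric]
  have mults: "?mult e (in_a a) = in_a a" "?mult (in_a a) e = in_a a"
    "?mult e (in_b b) = 0" "?mult (in_b b) e = 0"
    "?mult e (corner m) = corner m" "?mult (corner m) e = 0"
    "?mult (in_a a) (corner m) = corner (lact M a m)"
    "?mult (corner m) (in_a a) = 0"
    "?mult (in_b b) (corner m) = 0"
    "?mult (corner m) (in_b b) = corner (ract M m b)"
    "?mult (in_a a) (in_b b) = 0" "?mult (in_b b) (in_a a) = 0"
    "?mult (corner m) (corner m') = 0"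
    for a b m m'
    by (simp_all add: e_def corner_def T_simps)
  define p where "p m = tri_m (\<sigma> (corner m))" for m
  define q where "q m = tri_m (\<tau> (corner m))" for m
  have pq: "\<sigma> (corner m) = corner (p m)" "\<tau> (corner m) = corner (q m)" for m
    unfolding p_def q_def by (simp_all add: corner_def \<sigma>.tri_eq_iff \<sigma>.tri_a \<sigma>.tri_b \<tau>.tri_a \<tau>.tri_b
        \<sigma>.restr_0 \<tau>.restr_0)
  \<comment> \<open>For each pair of Peirce components other than \<open>A \<times> A\<close> and \<open>B \<times> B\<close>, either \<open>left\<close> or \<open>right\<close>
    determines the value of \<open>d\<close> from a value of \<open>d e\<close>.\<close>
  have a: "?D (in_a a) (in_b t) = 0"
    "?D (in_a a) (corner u) = ?D e (corner (lact M (restr_a \<sigma> a) u))" for a t u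
    using right[of "in_a a" "in_b t"] left[of "in_a a" "corner u"]
    by (simp_all add: mults \<sigma>.Tri_a \<tau>.Tri_a)
  have b: "?D (in_b b) (in_a t) = 0"
    "?D (in_b b) (corner u) = - ?D e (corner (ract M u (restr_b \<tau> b)))" for b t u
    using left[of "in_b b" "in_a t"] right[of "in_b b" "corner u"]
    by (simp_all add: mults \<sigma>.Tri_b \<tau>.Tri_b D0 eq_neg_iff_add_eq_0)
  have m: "?D (corner m) (in_a t) = - ?D e (corner (lact M t (q m)))"
    "?D (corner m) (in_b t') = ?D e (corner (ract M (p m) t'))"
    "?D (corner m) (corner u) = 0" for m t t' u
    using right[of "corner m" "in_a t"] left[of "corner m" "in_b t'"] left[of "corner m" "corner u"]
    by (simp_all add: mults pq D0 eq_neg_iff_add_eq_0)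
  have split: "x = in_a (tri_a x) + corner (tri_m x) + in_b (tri_b x)" for x
    by (simp add: corner_def \<sigma>.tri_eq_iff)
  \<comment> \<open>The values of \<open>\<psi>\<close> on the corner are forced: if \<open>\<psi>\<close> implements \<open>d\<close>, then
    \<open>d e s = \<psi> (s e) - \<psi> (e s)\<close>, and a corner element \<open>s\<close> has \<open>s e = 0\<close> and \<open>e s = s\<close>.\<close>
  define \<psi> where "\<psi> = - (d e o\<^sub>L Blinfun (\<lambda>x :: ('a, 'm, 'b) tri. Tri 0 (tri_m x) 0))"
  have \<psi>: "blinfun_apply \<psi> s = - ?D e (corner (tri_m s))" for s
    by (simp add: \<psi>_def corner_def blinfun.bilinear_simps
        bounded_linear_Blinfun_apply[OF bounded_linear_corner])
  have corner_add: "corner (u + v) = corner u + corner v" for u v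
    by (simp add: corner_def \<sigma>.tri_eq_iff)
  show ?thesis
    unfolding \<sigma>.tri.twisted_inner_dual_iff
  proof (intro exI[of _ \<psi>] conjI allI)
    have "corner (tri_m (ascale T c s)) = ascale T c (corner (tri_m s))" for c s
      by (simp add: corner_def T_simps)
    then show "Vector_Spaces.linear (ascale T) (*) (blinfun_apply \<psi>)"
      using lin[of e] by (simp add: Vector_Spaces.linear_iff \<psi> corner_add blinfun.add_right)
  next
    fix x s
    have tri_m: "tri_m (\<sigma> x) = p (tri_m x)" "tri_m (\<tau> x) = q (tri_m x)"
      unfolding p_def q_def corner_def by (rule \<sigma>.tri_m \<tau>.tri_m)+
    have "?D x s = ?D (in_a (tri_a x) + corner (tri_m x) + in_b (tri_b x))
        (in_a (tri_a s) + corner (tri_m s) + in_b (tri_b s))"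
      using split[of x] split[of s] by simp
    also have "\<dots> = ?D (in_a (tri_a x)) (in_a (tri_a s)) + ?D (in_b (tri_b x)) (in_b (tri_b s)) +
        (blinfun_apply \<psi> (?mult s (\<tau> x)) - blinfun_apply \<psi> (?mult (\<sigma> x) s))"
      by (simp add: add_x blinfun.add_right a b m \<psi> \<sigma>.tri_alg_simps corner_add \<sigma>.tri_a \<sigma>.tri_b
          \<tau>.tri_a \<tau>.tri_b tri_m)
    finally show "blinfun_apply
        ((d - (pullback tri_a (pullback in_a d) + pullback tri_b (pullback in_b d))) x) s =
        blinfun_apply \<psi> (?mult s (\<tau> x)) - blinfun_apply \<psi> (?mult (\<sigma> x) s)"
      by (simp add: blinfun.bilinear_simps pullback_apply bounded_linear_tri_a bounded_linear_tri_b
          bounded_linear_Tri_a bounded_linear_Tri_b)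
  qed
qed

text \<open>
  The mixed composites vanish for any \<open>d\<close>, since the functionals obtained are evaluated at \<open>0\<close>.
\<close>

lemma pullback_in_out:
  "pullback in_a (pullback tri_a d) = d" "pullback in_b (pullback tri_b d') = d'"
  "pullback in_a (pullback tri_b d') = 0" "pullback in_b (pullback tri_a d) = 0"
  by (auto intro!: ext blinfun_eqI simp: pullback_apply bounded_linear_tri_a bounded_linear_tri_b
      bounded_linear_Tri_a bounded_linear_Tri_b blinfun.zero_right)

lemma H1_decomposition:
  "visomorphic (H1 T (dual T) \<sigma> \<tau>)
    (vdirect_sum (H1 A (dual A) (restr_a \<sigma>) (restr_a \<tau>)) (H1 B (dual B) (restr_b \<sigma>) (restr_b \<tau>)))"
  unfolding H1_def
proof (rule visomorphic_vquot_direct_sum[where ?r1.0 = "pullback in_a" and ?r2.0 = "pullback in_b"])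
  fix y z
  assume "y \<in> vcarrier (Z1 A (dual A) (restr_a \<sigma>) (restr_a \<tau>))"
    "z \<in> vcarrier (Z1 B (dual B) (restr_b \<sigma>) (restr_b \<tau>))"
  then have "pullback tri_a y + pullback tri_b z \<in> vcarrier (Z1 T (dual T) \<sigma> \<tau>)"
    by (intro \<sigma>.tri.Z1_dual_add out_a.pullback_in_Z1 out_b.pullback_in_Z1)
  then show "\<exists>x\<in>vcarrier (Z1 T (dual T) \<sigma> \<tau>). pullback in_a x = y \<and> pullback in_b x = z"
    by (rule rev_bexI) (simp add: pullback_add pullback_in_out)
next
  fix d
  assume d: "d \<in> vcarrier (Z1 T (dual T) \<sigma> \<tau>)"
  \<comment> \<open>Restrictions of inner derivations are inner.  Conversely \<open>d\<close> is the sum of an inner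
    derivation and \<open>?d'\<close>, which is inner as soon as both restrictions are.\<close>
  let ?d' = "pullback tri_a (pullback in_a d) + pullback tri_b (pullback in_b d)"
  have "twisted_inner T (dual T) \<sigma> \<tau> d"
    if "twisted_inner A (dual A) (restr_a \<sigma>) (restr_a \<tau>) (pullback in_a d)"
      "twisted_inner B (dual B) (restr_b \<sigma>) (restr_b \<tau>) (pullback in_b d)"
  proof -
    have "twisted_inner T (dual T) \<sigma> \<tau> ?d'"
      using that by (intro \<sigma>.tri.twisted_inner_dual_add out_a.twisted_inner_pullback
          out_b.twisted_inner_pullback)
    with twisted_inner_dual_minus_corners[OF d] have "twisted_inner T (dual T) \<sigma> \<tau> (d - ?d' + ?d')"
      by (rule \<sigma>.tri.twisted_inner_dual_add)
    then show ?thesis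
      by simp
  qed
  then show "d \<in> B1 T (dual T) \<sigma> \<tau> \<longleftrightarrow>
      pullback in_a d \<in> B1 A (dual A) (restr_a \<sigma>) (restr_a \<tau>) \<and>
      pullback in_b d \<in> B1 B (dual B) (restr_b \<sigma>) (restr_b \<tau>)"
    using d in_a.pullback_in_Z1[OF d] in_b.pullback_in_Z1[OF d]
      in_a.twisted_inner_pullback in_b.twisted_inner_pullback
    by (auto simp: B1_def)
qed (auto simp: vadd_Z1 pullback_add pullback_scale B1_subset_Z1
    intro: in_a.pullback_in_Z1 in_b.pullback_in_Z1 \<sigma>.tri.Z1_dual_diff \<sigma>.A.zero_in_B1_dual
      \<sigma>.B.zero_in_B1_dual \<sigma>.A.B1_dual_diff \<sigma>.B.B1_dual_diff)

end

theorem theorem3p1: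
  fixes A :: "('k::real_normed_field, 'a::banach) alg"
    and B :: "('k, 'b::banach) alg"
    and M :: "('k, 'a, 'b, 'm::banach) bimod"
    and T :: "('k, ('a, 'm, 'b) tri) alg"
    and \<sigma> \<tau> :: "('a, 'm, 'b) tri \<Rightarrow> ('a, 'm, 'b) tri"
  assumes "unital_banach_algebra A"
    and "unital_banach_algebra B"
    and "unital_banach_bimodule A B M"
    and "T = tri_alg A M B"
    and "continuous_hom T T \<sigma>"
    and "continuous_hom T T \<tau>"
    and "\<sigma> (Tri (aone A) 0 0) = Tri (aone A) 0 0"
    and "\<tau> (Tri (aone A) 0 0) = Tri (aone A) 0 0"
    and "\<sigma> (Tri 0 0 (aone B)) = Tri 0 0 (aone B)"
    and "\<tau> (Tri 0 0 (aone B)) = Tri 0 0 (aone B)"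
  shows "visomorphic (H1 T (dual T) \<sigma> \<tau>)
    (vdirect_sum (H1 A (dual A) (restr_a \<sigma>) (restr_a \<tau>))
      (H1 B (dual B) (restr_b \<sigma>) (restr_b \<tau>)))"
proof -
  interpret triangular_endomorphism_pair A B M \<sigma> \<tau>
    using assms by (simp add: triangular_endomorphism_pair_def triangular_endomorphism_def
        triangular_endomorphism_axioms_def)
  show ?thesis
    unfolding \<open>T = tri_alg A M B\<close> by (rule H1_decomposition)
qed

end
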